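(* Let $S\subset\mathbb{R}^K$ be compact and let $f$ be a positive, continuous probability density on $S$ (with respect to Lebesgue measure). Let $X_1,X_2,\dots$ be i.i.d. random vectors with density $f$. For any $\epsilon>0$ there exists a number $A>0$ such that for any $\delta>0$, the optimum information estimator $\hat f=\hat f_N$ based on $X_1,\dots,X_N$ and corresponding to the moments $T(x)=(x^\alpha)_{|\alpha|\le A}$ satisfies $$\lim_{N\to\infty}\Pr\left(H(f;\hat f_N)>\epsilon+\delta\right)=0 .$$
   Context: For a multi-index $\alpha=(\alpha_1,\dots,\alpha_K)$ of nonnegative integers, $|\alpha|=\sum_k\alpha_k$ and $x^\alpha=x_1^{\alpha_1}\cdots x_K^{\alpha_K}$. All integrals are over $S$ with respect to Lebesgue measure. Given a function $T:S\to\mathbb{R}^L$ and a sample $x_1,\dots,x_N\in S$, let $\hat T=\frac1N\sum_{n=1}^N T(x_n)$. The optimum information estimator $\hat f$ of $f$ corresponding to $T$ is the minimizer of $\int_S g(x)\log g(x)\,dx$ over $g\in L^1(S)$ subject to $\int_S T(x)g(x)\,dx=\hat T$ and $\int_S g(x)\,dx=1$ (conventions: $0\log 0=0$, $x\log x=+\infty$ for $x<0$). The probability in the claim refers to the event that $\hat f_N$ exists and $H(f;\hat f_N)>\epsilon+\delta$. For densities $f,g$ on $S$, the Kullback-Leibler information is $H(f;g)=\int_S f\log\frac{f}{g}\,dx$. *)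

theory Defs
  imports "HOL-Probability.Probability"
begin

(* Integral of an extended-real function as (integral of the positive part) - (integral of the
   negative part).  Unlike the Bochner integral it does not collapse divergent integrals to 0:
   the value is infinite when only the positive part diverges.  The indeterminate difference of
   two infinities does not occur for the two integrands below when g is integrable: their
   negative parts are dominated by exp (-1) on the compact set S and by |g|, respectively. *)
definition ereal_integral :: "'a measure \<Rightarrow> ('a \<Rightarrow> ereal) \<Rightarrow> ereal" where
  "ereal_integral M h =
     enn2ereal (\<integral>\<^sup>+x. e2ennreal (h x) \<partial>M) - enn2ereal (\<integral>\<^sup>+x. e2ennreal (- h x) \<partial>M)"

(* The case t = 0 gives 0, i.e. 0 log 0 = 0. *)
definition xlogx :: "real \<Rightarrow> ereal" where
  "xlogx t = (if t < 0 then \<infinity> else ereal (t * ln t))"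

definition neg_entropy :: "'a::euclidean_space set \<Rightarrow> ('a \<Rightarrow> real) \<Rightarrow> ereal" where
  "neg_entropy S g = ereal_integral (lebesgue_on S) (\<lambda>x. xlogx (g x))"

(* The convention - log b = + infinity for b \<le> 0 is built into the integrand; for b = 0 this is
   the usual one, and b < 0 does not occur (up to null sets) when g is a density. *)
definition kl_info :: "'a::euclidean_space set \<Rightarrow> ('a \<Rightarrow> real) \<Rightarrow> ('a \<Rightarrow> real) \<Rightarrow> ereal" where
  "kl_info S f g = ereal_integral (lebesgue_on S)
     (\<lambda>x. if f x = 0 then 0 else if g x \<le> 0 then \<infinity> else ereal (f x * ln (f x / g x)))"

definition sample_mean :: "('a \<Rightarrow> real) \<Rightarrow> nat \<Rightarrow> (nat \<Rightarrow> 'a) \<Rightarrow> real" where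
  "sample_mean h N x = (\<Sum>n<N. h (x n)) / real N"

(* A vector-valued statistic is given by its components T i, for i in the index set I. *)
definition moment_feasible ::
  "'a::euclidean_space set \<Rightarrow> 'i set \<Rightarrow> ('i \<Rightarrow> 'a \<Rightarrow> real) \<Rightarrow> ('i \<Rightarrow> real) \<Rightarrow> ('a \<Rightarrow> real) set" where
  "moment_feasible S I T t =
     {g. has_bochner_integral (lebesgue_on S) g 1 \<and>
         (\<forall>i\<in>I. has_bochner_integral (lebesgue_on S) (\<lambda>x. T i x * g x) (t i))}"

definition is_optimum_information_estimator ::
  "'a::euclidean_space set \<Rightarrow> 'i set \<Rightarrow> ('i \<Rightarrow> 'a \<Rightarrow> real) \<Rightarrow> nat \<Rightarrow> (nat \<Rightarrow> 'a) \<Rightarrow> ('a \<Rightarrow> real) \<Rightarrow> bool" where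
  "is_optimum_information_estimator S I T N x g \<longleftrightarrow>
     is_arg_min (neg_entropy S) (\<lambda>h. h \<in> moment_feasible S I T (\<lambda>i. sample_mean (T i) N x)) g"

definition multi_indices_upto :: "nat \<Rightarrow> ('k::finite \<Rightarrow> nat) set" where
  "multi_indices_upto A = {\<alpha>. (\<Sum>k\<in>UNIV. \<alpha> k) \<le> A}"

definition monomial :: "('k::finite \<Rightarrow> nat) \<Rightarrow> real ^ 'k \<Rightarrow> real" where
  "monomial \<alpha> x = (\<Prod>k\<in>UNIV. (x $ k) ^ \<alpha> k)"

end

theory Submission
  imports Defs
begin

text \<open>
The idea is that a density whose logarithm lies in the span of the constrained moments loses no
information, and that \<open>ln f\<close> nearly does. By Stone--Weierstrass there is a polynomial \<open>p\<close> with
\<open>\<bar>ln f - p\<bar> < \<epsilon> / 2\<close> on \<open>S\<close>, and \<open>A\<close> is a bound on its degree (\<open>Weierstrass_monomials\<close>).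

An estimator \<open>g\<close> minimizes the convex functional \<open>\<integral>g ln g\<close> over a convex set, so it satisfies a Pythagorean
inequality \<open>H(h; g) \<le> \<integral>h ln h - \<integral>g ln g\<close> for suitable feasible densities \<open>h\<close> (\<open>entropy_minimizer_pythagorean\<close>). All
feasible functions integrate \<open>p\<close> to the same value. If \<open>h\<close> is close to \<open>f\<close>, both entropies are therefore
compared with \<open>\<integral>p h\<close>: that of \<open>h\<close> exceeds it by little more than \<open>\<epsilon> / 2\<close>, and that of \<open>g\<close> falls short of it by at
most \<open>\<epsilon> / 2\<close>, by the Gibbs inequality. Hence \<open>H(h; g)\<close>, and with it \<open>H(f; g)\<close>, is little more than \<open>\<epsilon>\<close>
(\<open>entropy_minimizer_kl_info_le\<close>).

The density \<open>f\<close> itself is rarely feasible, since sample moments differ from true ones. With a system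
\<open>e j\<close> that is orthonormal under \<open>f\<close> and spans the monomials almost everywhere
(\<open>gram_schmidt_modulo_null_sets\<close>), and \<open>d j\<close> the difference between the sample mean and the expectation of
\<open>e j\<close>, the function \<open>h = f (1 + \<Sum>j. d j * e j)\<close> almost surely has the sample moments
(\<open>integral_mult_orthonormal_perturbation\<close>). By the law of large numbers all \<open>d j\<close> are small with probability
tending to one, and then \<open>h\<close> is uniformly close to \<open>f\<close>.
\<close>

section \<open>Entropy minimizers\<close>

text \<open>The Bregman divergence of \<open>t \<mapsto> t ln t\<close>. For two densities its integral is the Kullback--Leibler
information, because the linear terms cancel; unlike the integrand \<open>a ln (a / b)\<close> it is nonnegative
pointwise for \<open>a \<ge> 0\<close> and \<open>b > 0\<close>, so that monotonicity and Fatou's lemma apply to it.\<close>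

definition bregman :: "real \<Rightarrow> real \<Rightarrow> real" where
  "bregman a b = a * ln a - a * ln b - a + b"

lemma bregman_nonneg:
  assumes "0 \<le> a" "0 < b"
  shows "0 \<le> bregman a b"
proof (cases "a = 0")
  case False
  with assms have "a > 0" by simp
  with ln_le_minus_one[of "b / a"] assms have "ln b - ln a \<le> b / a - 1"
    by (simp add: ln_div)
  from mult_left_mono[OF this \<open>0 \<le> a\<close>] \<open>a > 0\<close> show ?thesis
    by (simp add: bregman_def algebra_simps)
qed (use assms in \<open>simp add: bregman_def\<close>)

text \<open>The gap between the chord and the graph of \<open>t ln t\<close> is the weighted sum of the divergences of the two
end points from the intermediate point. This turns minimality of an entropy into a bound on a
divergence.\<close>

lemma bregman_convex_combination:
  assumes "k = (1 - t) * a + t * b"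
  shows "(1 - t) * bregman a k + t * bregman b k
       = (1 - t) * (a * ln a) + t * (b * ln b) - k * ln k"
  unfolding bregman_def assms by algebra

text \<open>The difference of the two divergences contains \<open>q a ln (a / b)\<close>, which has no a priori bound. Multiplying
\<open>bregman a b\<close> by \<open>1 + q\<close> absorbs this term, and nonnegativity allows \<open>1 + q\<close> to be lowered to \<open>1 - \<rho>\<close>.\<close>

lemma bregman_multiplicative_perturbation:
  assumes "a > 0" "b > 0" "\<bar>q\<bar> \<le> \<rho>" "\<rho> < 1"
  shows "(1 - \<rho>) * bregman a b \<le> bregman (a * (1 + q)) b + \<rho> * a + \<rho> * b"
proof -
  have q: "1 + q > 0" using assms by linarith
  have "(1 - \<rho>) * bregman a b \<le> (1 + q) * bregman a b"
    using bregman_nonneg[of a b] assms by (intro mult_right_mono) auto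
  also have "\<dots> = bregman (a * (1 + q)) b - a * ((1 + q) * ln (1 + q)) + q * b"
    using ln_mult_pos[OF \<open>a > 0\<close> q] by (simp add: bregman_def algebra_simps)
  also have "\<dots> \<le> bregman (a * (1 + q)) b + \<rho> * a + \<rho> * b"
  proof -
    have "- \<rho> \<le> (1 + q) * ln (1 + q)"
      using bregman_nonneg[of "1 + q" 1] q assms by (simp add: bregman_def)
    hence "a * (- \<rho>) \<le> a * ((1 + q) * ln (1 + q))"
      using assms by (intro mult_left_mono) auto
    moreover have "q * b \<le> \<rho> * b" using assms by (intro mult_right_mono) auto
    ultimately show ?thesis by (simp add: algebra_simps)
  qed
  finally show ?thesis .
qed

lemma ereal_integral_eq_integral:
  assumes u: "integrable M u" and h: "AE x in M. h x = ereal (u x)"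
  shows "ereal_integral M h = ereal (\<integral>x. u x \<partial>M)"
proof -
  have "(\<integral>\<^sup>+x. e2ennreal (h x) \<partial>M) = (\<integral>\<^sup>+x. ennreal (u x) \<partial>M)"
    using h by (intro nn_integral_cong_AE) (auto elim!: eventually_mono simp: e2ennreal_ereal)
  moreover have "(\<integral>\<^sup>+x. e2ennreal (- h x) \<partial>M) = (\<integral>\<^sup>+x. ennreal (- u x) \<partial>M)"
    using h by (intro nn_integral_cong_AE) (auto elim!: eventually_mono simp: e2ennreal_ereal)
  moreover obtain p where "(\<integral>\<^sup>+x. ennreal (u x) \<partial>M) = ennreal p" "0 \<le> p"
    using integrableD(2)[OF u] by (cases "\<integral>\<^sup>+x. ennreal (u x) \<partial>M") auto
  moreover obtain n where "(\<integral>\<^sup>+x. ennreal (- u x) \<partial>M) = ennreal n" "0 \<le> n"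
    using integrableD(3)[OF u] by (cases "\<integral>\<^sup>+x. ennreal (- u x) \<partial>M") auto
  ultimately show ?thesis
    by (simp add: ereal_integral_def real_lebesgue_integral_def[OF u] enn2ereal_ennreal)
qed

lemma minus_one_le_mult_ln: "0 \<le> t \<Longrightarrow> - 1 \<le> t * ln (t::real)"
  using bregman_nonneg[of t 1] by (simp add: bregman_def)

text \<open>Since \<open>t ln t\<close> is bounded below on \<open>t \<ge> 0\<close>, a finite measure leaves only the positive part to diverge. Hence an
entropy below \<open>\<infinity>\<close> is a proper integral, and the value \<open>\<infinity>\<close> at negative arguments is met on a null set only.\<close>

lemma finite_neg_entropy_imp:
  assumes "finite_measure M" and g[measurable]: "g \<in> borel_measurable M"
    and fin: "ereal_integral M (\<lambda>x. xlogx (g x)) < \<infinity>"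
  shows "AE x in M. 0 \<le> g x" and "integrable M (\<lambda>x. g x * ln (g x))"
proof -
  interpret finite_measure M by fact
  have [measurable]: "(\<lambda>x. xlogx (g x)) \<in> borel_measurable M"
    unfolding xlogx_def by measurable
  have "(\<integral>\<^sup>+x. e2ennreal (- xlogx (g x)) \<partial>M) \<le> (\<integral>\<^sup>+x. 1 \<partial>M)"
  proof (intro nn_integral_mono)
    fix x
    have "- (g x * ln (g x)) \<le> 1" if "0 \<le> g x" using minus_one_le_mult_ln[OF that] by simp
    thus "e2ennreal (- xlogx (g x)) \<le> 1"
      by (auto simp: xlogx_def e2ennreal_ereal ennreal_le_1 e2ennreal_neg)
  qed
  also have "\<dots> < \<infinity>" by (simp add: emeasure_eq_measure)
  finally have neg: "(\<integral>\<^sup>+x. e2ennreal (- xlogx (g x)) \<partial>M) < \<infinity>" .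
  have pos: "(\<integral>\<^sup>+x. e2ennreal (xlogx (g x)) \<partial>M) \<noteq> \<infinity>"
  proof
    assume "(\<integral>\<^sup>+x. e2ennreal (xlogx (g x)) \<partial>M) = \<infinity>"
    with fin neg show False
      by (cases "\<integral>\<^sup>+x. e2ennreal (- xlogx (g x)) \<partial>M") (auto simp: ereal_integral_def enn2ereal_ennreal)
  qed
  have "AE x in M. e2ennreal (xlogx (g x)) \<noteq> \<infinity>"
    by (rule nn_integral_PInf_AE[OF _ pos]) measurable
  thus nonneg: "AE x in M. 0 \<le> g x"
    by eventually_elim (auto simp: xlogx_def split: if_splits)
  show "integrable M (\<lambda>x. g x * ln (g x))"
  proof -
    have "(\<integral>\<^sup>+x. ennreal (g x * ln (g x)) \<partial>M) = (\<integral>\<^sup>+x. e2ennreal (xlogx (g x)) \<partial>M)"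
      using nonneg by (intro nn_integral_cong_AE)
        (auto elim!: eventually_mono simp: xlogx_def e2ennreal_ereal)
    moreover have "(\<integral>\<^sup>+x. ennreal (- (g x * ln (g x))) \<partial>M) = (\<integral>\<^sup>+x. e2ennreal (- xlogx (g x)) \<partial>M)"
      using nonneg by (intro nn_integral_cong_AE)
        (auto elim!: eventually_mono simp: xlogx_def e2ennreal_ereal)
    ultimately show ?thesis using pos neg by (auto simp: real_integrable_def)
  qed
qed

text \<open>Convexity bounds the entropy integrand of a mixture above, and \<open>- 1\<close> bounds it below.\<close>

lemma integrable_mult_ln_convex_combination:
  fixes g h :: "'a \<Rightarrow> real"
  assumes "finite_measure M" "0 < t" "t < 1"
    and g: "g \<in> borel_measurable M" "AE x in M. 0 \<le> g x" "integrable M (\<lambda>x. g x * ln (g x))"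
    and h: "h \<in> borel_measurable M" "\<And>x. x \<in> space M \<Longrightarrow> 0 < h x" "integrable M (\<lambda>x. h x * ln (h x))"
  shows "integrable M (\<lambda>x. ((1 - t) * g x + t * h x) * ln ((1 - t) * g x + t * h x))"
proof -
  interpret finite_measure M by fact
  let ?k = "\<lambda>x. (1 - t) * g x + t * h x"
  let ?u = "\<lambda>x. (1 - t) * (g x * ln (g x)) + t * (h x * ln (h x))"
  show ?thesis
  proof (rule Bochner_Integration.integrable_bound)
    show "integrable M (\<lambda>x. \<bar>?u x\<bar> + 1)" using g h by auto
    show "(\<lambda>x. ?k x * ln (?k x)) \<in> borel_measurable M" using g(1) h(1) by measurable
    show "AE x in M. norm (?k x * ln (?k x)) \<le> norm (\<bar>?u x\<bar> + 1)"
      using g(2) AE_space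
    proof eventually_elim
      case (elim x)
      have k: "?k x > 0" using elim h(2)[of x] assms(2,3) by (intro add_nonneg_pos) auto
      have "?k x * ln (?k x) \<le> ?u x"
        using bregman_convex_combination[OF refl, of t "g x" "h x"]
          bregman_nonneg[OF _ k, of "g x"] bregman_nonneg[OF _ k, of "h x"] elim h(2)[of x] assms(2,3)
        by (smt (verit) mult_nonneg_nonneg)
      with minus_one_le_mult_ln[of "?k x"] k show ?case by auto
    qed
  qed
qed

text \<open>The Pythagorean inequality for entropy projections. For \<open>k = (1 - t) g + t h\<close> the identity for chords, integrated,
reads \<open>(1 - t) D(g; k) + t D(h; k) = (1 - t) E(g) + t E(h) - E(k)\<close>, with \<open>E\<close> the entropy integral and \<open>D\<close> the integrated
divergence. Minimality gives \<open>E(k) \<ge> E(g)\<close>, hence \<open>D(h; k) \<le> E(h) - E(g)\<close> for every \<open>t\<close>, and Fatou's lemma carries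
this to \<open>t \<rightarrow> 0\<close>. Where \<open>g\<close> vanishes the divergence tends to infinity, so \<open>g\<close> is positive almost everywhere.\<close>

lemma entropy_minimizer_pythagorean:
  fixes g h :: "'a \<Rightarrow> real"
  assumes fin: "finite_measure M"
    and g: "g \<in> borel_measurable M" "AE x in M. 0 \<le> g x" "integrable M (\<lambda>x. g x * ln (g x))"
    and h: "h \<in> borel_measurable M" "\<And>x. x \<in> space M \<Longrightarrow> 0 < h x" "integrable M (\<lambda>x. h x * ln (h x))"
    and min: "\<And>t. 0 < t \<Longrightarrow> t < 1 \<Longrightarrow> (\<integral>x. g x * ln (g x) \<partial>M)
        \<le> (\<integral>x. ((1 - t) * g x + t * h x) * ln ((1 - t) * g x + t * h x) \<partial>M)"
  shows "AE x in M. 0 < g x"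
    and "integrable M (\<lambda>x. bregman (h x) (g x))"
    and "(\<integral>x. bregman (h x) (g x) \<partial>M) \<le> (\<integral>x. h x * ln (h x) \<partial>M) - (\<integral>x. g x * ln (g x) \<partial>M)"
proof -
  interpret finite_measure M by fact
  note [measurable] = g(1) h(1)
  define D where "D = (\<integral>x. h x * ln (h x) \<partial>M) - (\<integral>x. g x * ln (g x) \<partial>M)"
  define k where "k t x = (1 - t) * g x + t * h x" for t x
  have [measurable]: "k t \<in> borel_measurable M" for t unfolding k_def by measurable
  have k_pos: "k t x > 0" if "0 < t" "t < 1" "x \<in> space M" "0 \<le> g x" for t x
    unfolding k_def using that h(2)[of x] by (intro add_nonneg_pos) auto
  have bound: "(\<integral>\<^sup>+x. ennreal (bregman (h x) (k t x)) \<partial>M) \<le> ennreal D" and D_nonneg: "0 \<le> D"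
    if t: "0 < t" "t < 1" for t
  proof -
    let ?u = "\<lambda>x. ((1 - t) * (g x * ln (g x)) + t * (h x * ln (h x)) - k t x * ln (k t x)) / t"
    have int: "integrable M ?u"
      using g h integrable_mult_ln_convex_combination[OF fin t g h]
      unfolding k_def by auto
    have le: "AE x in M. 0 \<le> bregman (h x) (k t x) \<and> bregman (h x) (k t x) \<le> ?u x"
      using g(2) AE_space
    proof eventually_elim
      case (elim x)
      note k = k_pos[OF t elim(2,1)]
      have "0 \<le> (1 - t) * bregman (g x) (k t x)"
        using bregman_nonneg[OF elim(1) k] t by auto
      with bregman_convex_combination[OF k_def[of t x]] have
        "t * bregman (h x) (k t x) \<le> ?u x * t" using t by simp
      with t bregman_nonneg[OF _ k, of "h x"] h(2)[OF elim(2)] show ?case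
        by (simp add: pos_le_divide_eq mult.commute)
    qed
    have mono: "AE x in M. ennreal (bregman (h x) (k t x)) \<le> ennreal (?u x)"
      using le by eventually_elim (auto intro: ennreal_leI)
    have u_nonneg: "AE x in M. 0 \<le> ?u x"
      using le by eventually_elim linarith
    have "(\<integral>\<^sup>+x. ennreal (bregman (h x) (k t x)) \<partial>M) \<le> (\<integral>\<^sup>+x. ennreal (?u x) \<partial>M)"
      by (rule nn_integral_mono_AE[OF mono])
    also have "\<dots> = ennreal (\<integral>x. ?u x \<partial>M)"
      by (rule nn_integral_eq_integral[OF int u_nonneg])
    finally have 1: "(\<integral>\<^sup>+x. ennreal (bregman (h x) (k t x)) \<partial>M) \<le> ennreal (\<integral>x. ?u x \<partial>M)" .
    have "(\<integral>x. ?u x \<partial>M) = ((1 - t) * (\<integral>x. g x * ln (g x) \<partial>M)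
        + t * (\<integral>x. h x * ln (h x) \<partial>M) - (\<integral>x. k t x * ln (k t x) \<partial>M)) / t"
      using g h integrable_mult_ln_convex_combination[OF fin t g h]
      unfolding k_def by simp
    also have "\<dots> \<le> D"
      using min[OF t] t unfolding k_def[symmetric] D_def by (simp add: field_simps)
    finally have 2: "(\<integral>x. ?u x \<partial>M) \<le> D" .
    show "(\<integral>\<^sup>+x. ennreal (bregman (h x) (k t x)) \<partial>M) \<le> ennreal D"
      using 1 ennreal_leI[OF 2] by (rule order_trans)
    have "0 \<le> (\<integral>x. ?u x \<partial>M)"
      by (rule integral_nonneg_AE[OF u_nonneg])
    with 2 show "0 \<le> D" by simp
  qed
  define t where "t n = inverse (real (Suc (Suc n)))" for n
  have t: "0 < t n" "t n < 1" for n
    by (auto simp: t_def inverse_eq_divide)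
  have t0: "t \<longlonglongrightarrow> 0"
    unfolding t_def using LIMSEQ_inverse_real_of_nat LIMSEQ_Suc by blast
  \<comment> \<open>With \<open>ln 0 = 0\<close> the formula for the divergence has a finite value at \<open>g x = 0\<close>; the limit there is
      infinite, so it is set by hand.\<close>
  define \<Phi> where "\<Phi> x = (if g x = 0 then \<infinity> else ennreal (bregman (h x) (g x)))" for x
  have [measurable]: "\<Phi> \<in> borel_measurable M" unfolding \<Phi>_def bregman_def by measurable
  have lim: "AE x in M. (\<lambda>n. ennreal (bregman (h x) (k (t n) x))) \<longlonglongrightarrow> \<Phi> x"
    using g(2) AE_space
  proof eventually_elim
    case (elim x)
    note hx = h(2)[OF elim(2)]
    have lk: "(\<lambda>n. k (t n) x) \<longlonglongrightarrow> g x"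
      unfolding k_def using t0 by (auto intro!: tendsto_eq_intros)
    show ?case
    proof (cases "g x = 0")
      case False
      with lk show ?thesis unfolding \<Phi>_def bregman_def
        by (auto intro!: tendsto_intros)
    next
      case True
      have lc: "(\<lambda>n. h x * ln (h x) - h x + k (t n) x) \<longlonglongrightarrow> h x * ln (h x) - h x + g x"
        by (intro tendsto_intros lk)
      have "filterlim (\<lambda>n. k (t n) x) (at_right 0) sequentially"
        using lk k_pos[OF t elim(2,1)] True
        by (auto simp: filterlim_at less_imp_neq[THEN not_sym])
      hence "filterlim (\<lambda>n. ln (k (t n) x)) at_bot sequentially"
        by (rule filterlim_compose[OF ln_at_0])
      hence "filterlim (\<lambda>n. - ln (k (t n) x)) at_top sequentially"
        by (simp add: filterlim_uminus_at_top)
      hence "filterlim (\<lambda>n. h x * (- ln (k (t n) x))) at_top sequentially"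
        by (rule filterlim_tendsto_pos_mult_at_top[OF tendsto_const hx])
      hence "filterlim (\<lambda>n. (h x * ln (h x) - h x + k (t n) x) + h x * (- ln (k (t n) x))) at_top sequentially"
        by (rule filterlim_tendsto_add_at_top[OF lc])
      hence "filterlim (\<lambda>n. bregman (h x) (k (t n) x)) at_top sequentially"
        by (simp add: bregman_def algebra_simps)
      hence "(\<lambda>n. ennreal (bregman (h x) (k (t n) x))) \<longlonglongrightarrow> \<infinity>"
        using ennreal_tendsto_top_eq_at_top by (metis infinity_ennreal_def)
      thus ?thesis using True by (simp add: \<Phi>_def)
    qed
  qed
  have "(\<integral>\<^sup>+x. \<Phi> x \<partial>M) = (\<integral>\<^sup>+x. liminf (\<lambda>n. ennreal (bregman (h x) (k (t n) x))) \<partial>M)"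
    using lim by (intro nn_integral_cong_AE)
      (auto elim!: eventually_mono dest!: lim_imp_Liminf[OF trivial_limit_sequentially])
  also have "\<dots> \<le> liminf (\<lambda>n. \<integral>\<^sup>+x. ennreal (bregman (h x) (k (t n) x)) \<partial>M)"
    unfolding bregman_def by (rule nn_integral_liminf) measurable
  also have "\<dots> \<le> ennreal D"
    by (intro Liminf_le) (auto intro!: always_eventually bound t)
  finally have \<Phi>: "(\<integral>\<^sup>+x. \<Phi> x \<partial>M) \<le> ennreal D" .
  have "AE x in M. \<Phi> x \<noteq> \<infinity>"
    by (rule nn_integral_PInf_AE) (use \<Phi> in \<open>auto simp: top_unique\<close>)
  with g(2) show pos: "AE x in M. 0 < g x"
    by eventually_elim (auto simp: \<Phi>_def split: if_splits)
  have nonneg: "AE x in M. 0 \<le> bregman (h x) (g x)"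
    using pos AE_space by eventually_elim (use h(2) bregman_nonneg in \<open>auto intro: less_imp_le\<close>)
  have "(\<integral>\<^sup>+x. ennreal (bregman (h x) (g x)) \<partial>M) = (\<integral>\<^sup>+x. \<Phi> x \<partial>M)"
    using pos by (intro nn_integral_cong_AE) (auto elim!: eventually_mono simp: \<Phi>_def)
  with \<Phi> have le: "(\<integral>\<^sup>+x. ennreal (bregman (h x) (g x)) \<partial>M) \<le> ennreal D" by simp
  show int: "integrable M (\<lambda>x. bregman (h x) (g x))"
    by (rule integrableI_nonneg)
      (use le nonneg in \<open>auto simp: bregman_def top_unique less_top[symmetric] order.strict_iff_order\<close>)
  show "(\<integral>x. bregman (h x) (g x) \<partial>M) \<le> (\<integral>x. h x * ln (h x) \<partial>M) - (\<integral>x. g x * ln (g x) \<partial>M)"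
    using le nn_integral_eq_integral[OF int nonneg] D_nonneg[OF t[of 0]]
    unfolding D_def by simp
qed

section \<open>Information lost by an entropy minimizer\<close>

lemma moment_feasible_convex_combination:
  assumes "g \<in> moment_feasible S I T \<tau>" "h \<in> moment_feasible S I T \<tau>"
  shows "(\<lambda>x. (1 - t) * g x + t * h x) \<in> moment_feasible S I T \<tau>"
proof -
  have "has_bochner_integral (lebesgue_on S) (\<lambda>x. w x * ((1 - t) * g x + t * h x)) r"
    if "has_bochner_integral (lebesgue_on S) (\<lambda>x. w x * g x) r"
       "has_bochner_integral (lebesgue_on S) (\<lambda>x. w x * h x) r" for w r
  proof -
    have "has_bochner_integral (lebesgue_on S)
        (\<lambda>x. (1 - t) * (w x * g x) + t * (w x * h x)) ((1 - t) * r + t * r)"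
      by (intro has_bochner_integral_add has_bochner_integral_mult_right that)
    thus ?thesis by (simp add: algebra_simps)
  qed
  from this[of "\<lambda>_. 1"] this show ?thesis
    using assms by (simp add: moment_feasible_def)
qed

text \<open>A combination of the constrained statistics has the same integral against all feasible functions; this
is how two feasible functions are compared.\<close>

lemma moment_feasible_integral_sum:
  assumes "finite I" "g \<in> moment_feasible S I T \<tau>"
  shows "has_bochner_integral (lebesgue_on S) (\<lambda>x. (\<Sum>i\<in>I. c i * T i x) * g x) (\<Sum>i\<in>I. c i * \<tau> i)"
proof -
  have "has_bochner_integral (lebesgue_on S) (\<lambda>x. \<Sum>i\<in>I. c i * (T i x * g x)) (\<Sum>i\<in>I. c i * \<tau> i)"
    using assms(2)
    by (intro has_bochner_integral_sum has_bochner_integral_mult_right)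
       (auto simp: moment_feasible_def)
  thus ?thesis by (simp add: sum_distrib_right mult.assoc)
qed

text \<open>The deterministic core. Let \<open>h = f (1 + q)\<close> be feasible, and let the span of the statistics contain a function
\<open>p\<close> within \<open>\<eta>\<close> of \<open>ln f\<close>. Feasibility forces \<open>\<integral>p g = \<integral>p h =: P\<close>. The Gibbs inequality against \<open>f\<close> gives
\<open>\<integral>g ln g \<ge> P - \<eta>\<close>, and \<open>ln h \<le> p + \<eta> + \<rho>\<close> gives \<open>\<integral>h ln h \<le> P + \<eta> + \<rho>\<close>. By the Pythagorean inequality the divergence of
\<open>h\<close> from \<open>g\<close> is at most \<open>2 \<eta> + \<rho>\<close>, and replacing \<open>h\<close> by \<open>f\<close> costs \<open>2 \<rho>\<close> and the factor \<open>1 - \<rho>\<close>.\<close>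

lemma entropy_minimizer_kl_info_le:
  fixes S :: "'a::euclidean_space set" and f p q g :: "'a \<Rightarrow> real"
  assumes S: "compact S" and cont: "continuous_on S f" and pos: "\<And>x. x \<in> S \<Longrightarrow> 0 < f x"
    and f1: "(\<integral>x. f x \<partial>lebesgue_on S) = 1"
    and I: "finite I"
    and p: "p = (\<lambda>x. \<Sum>i\<in>I. c i * T i x)" "\<And>x. x \<in> S \<Longrightarrow> \<bar>ln (f x) - p x\<bar> \<le> \<eta>"
    and q: "q \<in> borel_measurable (lebesgue_on S)" "\<And>x. x \<in> S \<Longrightarrow> \<bar>q x\<bar> \<le> \<rho>" 
    and \<rho>: "0 \<le> \<rho>" "\<rho> < 1"
    and h: "(\<lambda>x. f x * (1 + q x)) \<in> moment_feasible S I T \<tau>"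
    and g: "is_arg_min (neg_entropy S) (\<lambda>h. h \<in> moment_feasible S I T \<tau>) g"
  shows "kl_info S f g \<le> ereal ((2 * \<eta> + 3 * \<rho>) / (1 - \<rho>))"
proof -
  let ?\<mu> = "lebesgue_on S"
  define h where "h = (\<lambda>x. f x * (1 + q x))"
  have Sl: "S \<in> lmeasurable" using S by (rule lmeasurable_compact)
  have space: "space ?\<mu> = S" by simp
  have fin: "finite_measure ?\<mu>"
    by (rule finite_measure_lebesgue_on[OF Sl])
  interpret finite_measure ?\<mu> by (rule fin)
  have f_meas [measurable]: "f \<in> borel_measurable ?\<mu>"
    using continuous_imp_measurable_on_sets_lebesgue[OF cont] Sl by auto
  note [measurable] = q(1)
  obtain F where F: "\<And>x. x \<in> S \<Longrightarrow> \<bar>f x\<bar> \<le> F"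
    using compact_imp_bounded[OF compact_continuous_image[OF cont S]]
    by (auto simp: bounded_iff)
  obtain L where L: "\<And>x. x \<in> S \<Longrightarrow> \<bar>ln (f x)\<bar> \<le> L"
  proof -
    have "continuous_on S (\<lambda>x. ln (f x))"
      using pos by (intro continuous_on_ln cont) (auto simp: less_imp_neq[THEN not_sym])
    from compact_imp_bounded[OF compact_continuous_image[OF this S]] that
    show ?thesis by (auto simp: bounded_iff)
  qed
  have f_int: "integrable ?\<mu> f"
    using f1 by (rule_tac ccontr) (simp add: not_integrable_integral_eq)
  have hm [measurable]: "h \<in> borel_measurable ?\<mu>" unfolding h_def by measurable
  have q_pos: "0 < 1 + q x" if "x \<in> S" for x using q(2)[OF that] \<rho> by linarith
  have h_pos: "0 < h x" if "x \<in> S" for x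
    unfolding h_def using pos[OF that] q_pos[OF that] by simp
  have ln_h: "ln (h x) = ln (f x) + ln (1 + q x)" if "x \<in> S" for x
    unfolding h_def using pos[OF that] q_pos[OF that] by (rule ln_mult_pos)
  have hF: "h \<in> moment_feasible S I T \<tau>" using h unfolding h_def .
  have gF: "g \<in> moment_feasible S I T \<tau>" using g by (simp add: is_arg_min_def)
  have h1: "has_bochner_integral ?\<mu> h 1" and g1: "has_bochner_integral ?\<mu> g 1"
    using hF gF by (auto simp: moment_feasible_def)
  note h_int = integrable.intros[OF h1] and g_int = integrable.intros[OF g1]
  note gm [measurable] = borel_measurable_integrable[OF g_int]
  have ln_h_upper: "ln (h x) \<le> p x + \<eta> + \<rho>" if "x \<in> S" for x
    using ln_h[OF that] p(2)[OF that] q(2)[OF that] ln_add_one_self_le_self2[of "q x"] q_pos[OF that]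
    by (auto simp: abs_le_iff)
  have hlnh: "integrable ?\<mu> (\<lambda>x. h x * ln (h x))"
  proof (rule Bochner_Integration.integrable_bound)
    show "integrable ?\<mu> (\<lambda>x. \<bar>h x * (L + \<rho>)\<bar> + 1)" using h_int by auto
    show "AE x in ?\<mu>. norm (h x * ln (h x)) \<le> norm (\<bar>h x * (L + \<rho>)\<bar> + 1)"
    proof (rule AE_I2)
      fix x assume "x \<in> space ?\<mu>"
      hence x: "x \<in> S" by simp
      have "ln (h x) \<le> L + \<rho>"
        using ln_h[OF x] L[OF x] q(2)[OF x] ln_add_one_self_le_self2[of "q x"] q_pos[OF x] by auto
      hence "h x * ln (h x) \<le> h x * (L + \<rho>)"
        using h_pos[OF x] by (intro mult_left_mono) auto
      with minus_one_le_mult_ln[of "h x"] h_pos[OF x]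
      show "norm (h x * ln (h x)) \<le> norm (\<bar>h x * (L + \<rho>)\<bar> + 1)"
        unfolding real_norm_def by linarith
    qed
  qed measurable
  have neg_entropy_real: "neg_entropy S k = ereal (\<integral>x. k x * ln (k x) \<partial>?\<mu>)"
    if "integrable ?\<mu> (\<lambda>x. k x * ln (k x))" "AE x in ?\<mu>. 0 \<le> k x" for k
    unfolding neg_entropy_def using that(2)
    by (intro ereal_integral_eq_integral[OF that(1)]) (auto elim!: eventually_mono simp: xlogx_def)
  have h_nonneg: "AE x in ?\<mu>. 0 \<le> h x" using h_pos by (intro AE_I2) (auto intro: less_imp_le)
  have min: "neg_entropy S g \<le> neg_entropy S k" if "k \<in> moment_feasible S I T \<tau>" for k
    using g that by (auto simp: is_arg_min_def not_less)
  have g_fin: "ereal_integral ?\<mu> (\<lambda>x. xlogx (g x)) < \<infinity>"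
    using min[OF hF] neg_entropy_real[OF hlnh h_nonneg] by (auto simp: neg_entropy_def)
  note g_nonneg = finite_neg_entropy_imp(1)[OF fin gm g_fin]
  note glng = finite_neg_entropy_imp(2)[OF fin gm g_fin]
  have min': "(\<integral>x. g x * ln (g x) \<partial>?\<mu>)
     \<le> (\<integral>x. ((1 - t) * g x + t * h x) * ln ((1 - t) * g x + t * h x) \<partial>?\<mu>)" if t: "0 < t" "t < 1" for t
  proof -
    have nn: "AE x in ?\<mu>. 0 \<le> (1 - t) * g x + t * h x"
      using g_nonneg h_nonneg by eventually_elim (use t in auto)
    have "integrable ?\<mu> (\<lambda>x. ((1 - t) * g x + t * h x) * ln ((1 - t) * g x + t * h x))"
      by (rule integrable_mult_ln_convex_combination[OF fin t gm g_nonneg glng hm _ hlnh]) (use h_pos in simp)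
    with min[OF moment_feasible_convex_combination[OF gF hF, of t]] show ?thesis
      by (simp add: neg_entropy_real[OF glng g_nonneg] neg_entropy_real[OF _ nn])
  qed
  have pyth: "AE x in ?\<mu>. 0 < g x" "integrable ?\<mu> (\<lambda>x. bregman (h x) (g x))"
    "(\<integral>x. bregman (h x) (g x) \<partial>?\<mu>) \<le> (\<integral>x. h x * ln (h x) \<partial>?\<mu>) - (\<integral>x. g x * ln (g x) \<partial>?\<mu>)"
    by (rule entropy_minimizer_pythagorean[OF fin gm g_nonneg glng hm _ hlnh min'];
        use h_pos in simp)+

  have gp: "has_bochner_integral ?\<mu> (\<lambda>x. p x * g x) (\<Sum>i\<in>I. c i * \<tau> i)"
   and hp: "has_bochner_integral ?\<mu> (\<lambda>x. p x * h x) (\<Sum>i\<in>I. c i * \<tau> i)"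
    unfolding p(1) by (rule moment_feasible_integral_sum[OF I gF] moment_feasible_integral_sum[OF I hF])+
  let ?P = "\<Sum>i\<in>I. c i * \<tau> i"
  \<comment> \<open>The Gibbs inequality for \<open>g\<close> against \<open>f\<close>, with \<open>ln f\<close> replaced by \<open>p\<close>.\<close>
  have "(\<integral>x. g x * ln (g x) \<partial>?\<mu>) \<ge> ?P - \<eta>"
  proof -
    have "(\<integral>x. p x * g x - \<eta> * g x + g x - f x \<partial>?\<mu>) \<le> (\<integral>x. g x * ln (g x) \<partial>?\<mu>)"
    proof (rule integral_mono_AE)
      show "AE x in ?\<mu>. p x * g x - \<eta> * g x + g x - f x \<le> g x * ln (g x)"
        using g_nonneg AE_space
      proof eventually_elim
        case (elim x)
        hence x: "x \<in> S" by simp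
        have "g x * (p x - \<eta>) \<le> g x * ln (f x)"
          using p(2)[OF x] elim by (intro mult_left_mono) auto
        moreover have "0 \<le> g x * ln (g x) - g x * ln (f x) - g x + f x"
          using bregman_nonneg[OF elim(1) pos[OF x]] by (simp add: bregman_def)
        ultimately show ?case by (simp add: algebra_simps)
      qed
    qed (use gp g_int f_int glng in \<open>auto simp: has_bochner_integral_iff\<close>)
    also have "(\<integral>x. p x * g x - \<eta> * g x + g x - f x \<partial>?\<mu>) = ?P - \<eta>"
      using gp g1 f_int f1 by (simp add: has_bochner_integral_iff)
    finally show ?thesis by simp
  qed
  moreover have "(\<integral>x. h x * ln (h x) \<partial>?\<mu>) \<le> ?P + \<eta> + \<rho>"
  proof -
    have "(\<integral>x. h x * ln (h x) \<partial>?\<mu>) \<le> (\<integral>x. p x * h x + (\<eta> + \<rho>) * h x \<partial>?\<mu>)"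
    proof (rule integral_mono[OF hlnh])
      fix x assume "x \<in> space ?\<mu>"
      hence x: "x \<in> S" by simp
      from mult_left_mono[OF ln_h_upper[OF x], of "h x"] h_pos[OF x]
      show "h x * ln (h x) \<le> p x * h x + (\<eta> + \<rho>) * h x" by (simp add: algebra_simps)
    qed (use hp h_int in \<open>auto simp: has_bochner_integral_iff\<close>)
    also have "\<dots> = ?P + \<eta> + \<rho>"
      using hp h1 by (simp add: has_bochner_integral_iff)
    finally show ?thesis .
  qed
  ultimately have hg: "(\<integral>x. bregman (h x) (g x) \<partial>?\<mu>) \<le> 2 * \<eta> + \<rho>"
    using pyth(3) by simp

  have le: "AE x in ?\<mu>. 0 \<le> bregman (f x) (g x) \<and>
      (1 - \<rho>) * bregman (f x) (g x) \<le> bregman (h x) (g x) + \<rho> * f x + \<rho> * g x"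
    using pyth(1) AE_space
  proof eventually_elim
    case (elim x)
    hence x: "x \<in> S" by simp
    show ?case
      using bregman_nonneg[OF less_imp_le[OF pos[OF x]] elim(1)]
        bregman_multiplicative_perturbation[OF pos[OF x] elim(1) q(2)[OF x] \<rho>(2)]
      by (simp add: h_def)
  qed
  let ?u = "\<lambda>x. bregman (h x) (g x) + \<rho> * f x + \<rho> * g x"
  have u_int: "integrable ?\<mu> ?u" using pyth(2) f_int g_int by auto
  have fg_int: "integrable ?\<mu> (\<lambda>x. bregman (f x) (g x))"
  proof (rule Bochner_Integration.integrable_bound)
    show "integrable ?\<mu> (\<lambda>x. ?u x / (1 - \<rho>))" using u_int by auto
    show "AE x in ?\<mu>. norm (bregman (f x) (g x)) \<le> norm (?u x / (1 - \<rho>))"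
      using le
    proof eventually_elim
      case (elim x)
      hence "bregman (f x) (g x) \<le> ?u x / (1 - \<rho>)"
        using \<rho> by (simp add: pos_le_divide_eq mult.commute)
      with elim show ?case unfolding real_norm_def by linarith
    qed
  qed (simp add: bregman_def)
  have "(1 - \<rho>) * (\<integral>x. bregman (f x) (g x) \<partial>?\<mu>) = (\<integral>x. (1 - \<rho>) * bregman (f x) (g x) \<partial>?\<mu>)"
    by simp
  also have "\<dots> \<le> (\<integral>x. ?u x \<partial>?\<mu>)"
  proof (rule integral_mono_AE[OF _ u_int])
    show "AE x in ?\<mu>. (1 - \<rho>) * bregman (f x) (g x) \<le> ?u x"
      using le by eventually_elim simp
  qed (use fg_int in auto)
  also have "\<dots> = (\<integral>x. bregman (h x) (g x) \<partial>?\<mu>) + 2 * \<rho>"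
    using pyth(2) f_int g1 f1 by (simp add: has_bochner_integral_iff)
  also have "\<dots> \<le> 2 * \<eta> + 3 * \<rho>" using hg by simp
  finally have fg: "(\<integral>x. bregman (f x) (g x) \<partial>?\<mu>) \<le> (2 * \<eta> + 3 * \<rho>) / (1 - \<rho>)"
    using \<rho> by (simp add: pos_le_divide_eq mult.commute)

  have "kl_info S f g = ereal (\<integral>x. bregman (f x) (g x) + f x - g x \<partial>?\<mu>)"
    unfolding kl_info_def
  proof (rule ereal_integral_eq_integral)
    show "integrable ?\<mu> (\<lambda>x. bregman (f x) (g x) + f x - g x)" using fg_int f_int g_int by auto
    show "AE x in ?\<mu>. (if f x = 0 then 0 else if g x \<le> 0 then \<infinity> else ereal (f x * ln (f x / g x)))
        = ereal (bregman (f x) (g x) + f x - g x)"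
      using pyth(1) AE_space
    proof eventually_elim
      case (elim x)
      with pos[of x] show ?case by (auto simp: bregman_def ln_div algebra_simps)
    qed
  qed
  also have "(\<integral>x. bregman (f x) (g x) + f x - g x \<partial>?\<mu>) = (\<integral>x. bregman (f x) (g x) \<partial>?\<mu>)"
    using fg_int f_int f1 g1 by (simp add: has_bochner_integral_iff)
  finally show ?thesis using fg by simp
qed

section \<open>Orthonormal systems and sample means\<close>

text \<open>The bound is required on \<open>S\<close> only: monomials are unbounded on the whole space, while the sampling
distribution lives on the compact set \<open>S\<close>.\<close>

definition bounded_measurable :: "'a measure \<Rightarrow> 'a set \<Rightarrow> ('a \<Rightarrow> real) \<Rightarrow> bool" where
  "bounded_measurable D S u \<longleftrightarrow> u \<in> borel_measurable D \<and> (\<exists>B. \<forall>x\<in>S. \<bar>u x\<bar> \<le> B)"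

lemma bounded_measurable_const: "bounded_measurable D S (\<lambda>_. c)"
  by (auto simp: bounded_measurable_def)

lemma bounded_measurable_add:
  assumes "bounded_measurable D S u" "bounded_measurable D S v"
  shows "bounded_measurable D S (\<lambda>x. u x + v x)"
proof -
  obtain B C where "\<forall>x\<in>S. \<bar>u x\<bar> \<le> B" "\<forall>x\<in>S. \<bar>v x\<bar> \<le> C"
    using assms by (auto simp: bounded_measurable_def)
  hence "\<forall>x\<in>S. \<bar>u x + v x\<bar> \<le> B + C" by (auto intro: order_trans[OF abs_triangle_ineq] add_mono)
  thus ?thesis using assms by (auto simp: bounded_measurable_def)
qed

lemma bounded_measurable_mult:
  assumes "bounded_measurable D S u" "bounded_measurable D S v"
  shows "bounded_measurable D S (\<lambda>x. u x * v x)"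
proof -
  obtain B C where "\<forall>x\<in>S. \<bar>u x\<bar> \<le> B" "\<forall>x\<in>S. \<bar>v x\<bar> \<le> C"
    using assms by (auto simp: bounded_measurable_def)
  hence "\<forall>x\<in>S. \<bar>u x * v x\<bar> \<le> B * C"
    by (auto simp: abs_mult intro!: mult_mono intro: order_trans[OF abs_ge_zero])
  thus ?thesis using assms by (auto simp: bounded_measurable_def)
qed

lemma bounded_measurable_sum:
  "(\<And>j. j \<in> J \<Longrightarrow> bounded_measurable D S (u j)) \<Longrightarrow> bounded_measurable D S (\<lambda>x. \<Sum>j\<in>J. u j x)"
  by (induction J rule: infinite_finite_induct)
     (auto intro: bounded_measurable_const bounded_measurable_add)

lemma bounded_measurable_diff:
  assumes "bounded_measurable D S u" "bounded_measurable D S v"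
  shows "bounded_measurable D S (\<lambda>x. u x - v x)"
  using bounded_measurable_add[OF assms(1) bounded_measurable_mult[OF bounded_measurable_const[of _ _ "-1"] assms(2)]]
  by simp

lemmas bounded_measurable_intros = bounded_measurable_const bounded_measurable_add
  bounded_measurable_mult bounded_measurable_sum bounded_measurable_diff

lemma bounded_measurable_integrable:
  assumes "finite_measure D" "AE x in D. x \<in> S" "bounded_measurable D S u"
  shows "integrable D u"
proof -
  interpret finite_measure D by fact
  obtain B where "\<forall>x\<in>S. \<bar>u x\<bar> \<le> B" using assms(3) by (auto simp: bounded_measurable_def)
  thus ?thesis using assms(2,3)
    by (intro integrable_const_bound[where B = B]) (auto simp: bounded_measurable_def elim!: eventually_mono)
qed

definition orthonormal_system :: "'a measure \<Rightarrow> 'a set \<Rightarrow> nat \<Rightarrow> (nat \<Rightarrow> 'a \<Rightarrow> real) \<Rightarrow> bool" where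
  "orthonormal_system D S m e \<longleftrightarrow> (\<forall>j<m. bounded_measurable D S (e j)) \<and>
     (\<forall>j<m. \<forall>k<m. (\<integral>x. e j x * e k x \<partial>D) = (if j = k then 1 else 0))"

lemma integral_mult_orthonormal_combination:
  assumes D: "finite_measure D" "AE x in D. x \<in> S" and e: "orthonormal_system D S m e"
    and k: "k < m"
  shows "(\<integral>x. e k x * (\<Sum>j<m. c j * e j x) \<partial>D) = c k"
proof -
  have "(\<integral>x. e k x * (\<Sum>j<m. c j * e j x) \<partial>D) = (\<integral>x. (\<Sum>j<m. c j * (e k x * e j x)) \<partial>D)"
    by (simp add: sum_distrib_left mult_ac)
  also have "\<dots> = (\<Sum>j<m. c j * (\<integral>x. e k x * e j x \<partial>D))"
    using e k by (subst Bochner_Integration.integral_sum)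
      (auto simp: orthonormal_system_def intro!: bounded_measurable_integrable[OF D] bounded_measurable_intros)
  also have "\<dots> = (\<Sum>j<m. if j = k then c j else 0)"
    using e k by (intro sum.cong) (auto simp: orthonormal_system_def)
  also have "\<dots> = c k" using k by simp
  finally show ?thesis .
qed

text \<open>Statistics that are linearly dependent \<open>D\<close>-almost everywhere have a singular Gram matrix. So a residual of
norm zero adds no new member to the system, and the expansions hold up to null sets.\<close>

lemma gram_schmidt_modulo_null_sets:
  assumes D: "finite_measure D" "AE x in D. x \<in> S"
    and "finite I" "\<And>i. i \<in> I \<Longrightarrow> bounded_measurable D S (T i)"
  shows "\<exists>m e. orthonormal_system D S m e \<and> (\<forall>i\<in>I. \<exists>a. AE x in D. T i x = (\<Sum>j<m. a j * e j x))"
  using assms(3,4)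
proof (induction I rule: finite_induct)
  case empty
  show ?case by (intro exI[of _ "0::nat"]) (auto simp: orthonormal_system_def)
next
  case (insert i I)
  then obtain m e where e: "orthonormal_system D S m e"
    and a: "\<And>i. i \<in> I \<Longrightarrow> \<exists>a. AE x in D. T i x = (\<Sum>j<m. a j * e j x)" by auto
  note int = bounded_measurable_integrable[OF D]
  have Ti: "bounded_measurable D S (T i)" using insert.prems by simp
  have bm: "bounded_measurable D S (e j)" if "j < m" for j
    using e that by (auto simp: orthonormal_system_def)
  define c where "c j = (\<integral>x. e j x * T i x \<partial>D)" for j
  define r where "r = (\<lambda>x. T i x - (\<Sum>j<m. c j * e j x))"
  have r: "bounded_measurable D S r"
    unfolding r_def using Ti bm by (auto intro!: bounded_measurable_intros)
  have orth: "(\<integral>x. e k x * r x \<partial>D) = 0" if k: "k < m" for k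
  proof -
    have "(\<integral>x. e k x * r x \<partial>D) = (\<integral>x. e k x * T i x - e k x * (\<Sum>j<m. c j * e j x) \<partial>D)"
      by (simp add: r_def algebra_simps)
    also have "\<dots> = c k - c k"
      using Ti bm k
      by (subst Bochner_Integration.integral_diff)
        (auto simp: c_def[of k, symmetric] integral_mult_orthonormal_combination[OF D e k]
              intro!: int bounded_measurable_intros)
    finally show ?thesis by simp
  qed
  define n where "n = (\<integral>x. r x * r x \<partial>D)"
  have n0: "0 \<le> n" unfolding n_def by (rule integral_nonneg_AE) simp
  show ?case
  proof (cases "n = 0")
    case True
    have "AE x in D. r x * r x = 0"
      using True unfolding n_def
      by (subst (asm) integral_nonneg_eq_0_iff_AE) (auto intro!: int bounded_measurable_intros r)
    hence "AE x in D. T i x = (\<Sum>j<m. c j * e j x)"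
      by eventually_elim (simp add: r_def)
    with a e show ?thesis by blast
  next
    case False
    with n0 have n: "0 < n" by simp
    define e' where "e' = e(m := (\<lambda>x. r x / sqrt n))"
    have e'm: "e' m = (\<lambda>x. r x * (1 / sqrt n))" and e'j: "\<And>j. j < m \<Longrightarrow> e' j = e j"
      by (auto simp: e'_def)
    have bm': "bounded_measurable D S (e' j)" if "j < Suc m" for j
      using that bm[of j] r by (cases "j = m")
        (auto simp: e'j e'm intro!: bounded_measurable_intros simp del: times_divide_eq_right)
    have "(\<integral>x. e' j x * e' k x \<partial>D) = (if j = k then 1 else 0)" if jk: "j < Suc m" "k < Suc m" for j k
    proof -
      consider "j < m" "k < m" | "j < m" "k = m" | "j = m" "k < m" | "j = m" "k = m"
        using jk by (auto simp: less_Suc_eq)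
      thus ?thesis
      proof cases
        case 1 thus ?thesis using e by (simp add: e'j orthonormal_system_def)
      next
        case 2 thus ?thesis using orth[of j] by (simp add: e'j e'm)
      next
        case 3 thus ?thesis using orth[of k] by (simp add: e'j e'm mult.commute)
      next
        case 4
        have "(\<integral>x. e' m x * e' m x \<partial>D) = (\<integral>x. (r x * r x) / n \<partial>D)"
          using n by (simp add: e'm)
        also have "\<dots> = 1" using n by (simp add: n_def[symmetric])
        finally show ?thesis using 4 by simp
      qed
    qed
    with bm' have "orthonormal_system D S (Suc m) e'" by (auto simp: orthonormal_system_def)
    moreover have "\<exists>a. AE x in D. T k x = (\<Sum>j<Suc m. a j * e' j x)" if k: "k \<in> insert i I" for k
    proof (cases "k = i")
      case True
      have "T i x = (\<Sum>j<Suc m. (c(m := sqrt n)) j * e' j x)" for x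
        using n by (simp add: e'j e'm r_def)
      thus ?thesis using True by blast
    next
      case False
      with k a obtain b where b: "AE x in D. T k x = (\<Sum>j<m. b j * e j x)" by auto
      have "(\<Sum>j<Suc m. (b(m := 0)) j * e' j x) = (\<Sum>j<m. b j * e j x)" for x
        by (simp add: e'j)
      with b show ?thesis by (intro exI[of _ "b(m := 0)"]) simp
    qed
    ultimately show ?thesis by blast
  qed
qed

text \<open>Tilting \<open>D\<close> by \<open>1 + \<Sum>k. d k * e k\<close> shifts the mean of each \<open>e j\<close> by exactly \<open>d j\<close>, and every function in the span
accordingly. With \<open>d j\<close> the deviation of a sample mean from its expectation, the tilted measure
reproduces the sample moments.\<close>

lemma integral_mult_orthonormal_perturbation:
  assumes D: "finite_measure D" "AE x in D. x \<in> S" and e: "orthonormal_system D S m e"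
    and u: "bounded_measurable D S u" "AE x in D. u x = (\<Sum>j<m. a j * e j x)"
  shows "(\<integral>x. u x * (1 + (\<Sum>k<m. d k * e k x)) \<partial>D) = (\<Sum>j<m. a j * ((\<integral>x. e j x \<partial>D) + d j))"
proof -
  note int = bounded_measurable_integrable[OF D]
  have bm: "bounded_measurable D S (e j)" if "j < m" for j
    using e that by (auto simp: orthonormal_system_def)
  have int1: "integrable D (e j)" "integrable D (\<lambda>x. e j x * (\<Sum>k<m. d k * e k x))" if "j < m" for j
    using bm that by (auto intro!: int bounded_measurable_intros)
  have "(\<integral>x. u x * (1 + (\<Sum>k<m. d k * e k x)) \<partial>D)
      = (\<integral>x. (\<Sum>j<m. a j * (e j x + e j x * (\<Sum>k<m. d k * e k x))) \<partial>D)"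
  proof (rule integral_cong_AE)
    show "AE x in D. u x * (1 + (\<Sum>k<m. d k * e k x))
        = (\<Sum>j<m. a j * (e j x + e j x * (\<Sum>k<m. d k * e k x)))"
      using u(2)
    proof eventually_elim
      case (elim x)
      have "(\<Sum>j<m. a j * (e j x + e j x * s)) = (\<Sum>j<m. a j * e j x) * (1 + s)" for s
        by (simp add: algebra_simps sum.distrib sum_distrib_left)
      with elim show ?case by simp
    qed
    have "integrable D (\<lambda>x. u x * (1 + (\<Sum>k<m. d k * e k x)))"
      using u(1) bm by (auto intro!: int bounded_measurable_intros)
    thus "(\<lambda>x. u x * (1 + (\<Sum>k<m. d k * e k x))) \<in> borel_measurable D" by simp
    have "integrable D (\<lambda>x. \<Sum>j<m. a j * (e j x + e j x * (\<Sum>k<m. d k * e k x)))"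
      using int1 by auto
    thus "(\<lambda>x. \<Sum>j<m. a j * (e j x + e j x * (\<Sum>k<m. d k * e k x))) \<in> borel_measurable D" by simp
  qed
  also have "\<dots> = (\<Sum>j<m. \<integral>x. a j * (e j x + e j x * (\<Sum>k<m. d k * e k x)) \<partial>D)"
    using int1 by (intro Bochner_Integration.integral_sum) auto
  also have "\<dots> = (\<Sum>j<m. a j * ((\<integral>x. e j x \<partial>D) + d j))"
    using int1 by (intro sum.cong) (auto simp: integral_mult_orthonormal_combination[OF D e])
  finally show ?thesis .
qed

text \<open>Connects the Borel law of the sample with integrals over the Lebesgue measure on \<open>S\<close>.\<close>

lemma has_bochner_integral_lebesgue_on_density:
  fixes f u :: "'a::euclidean_space \<Rightarrow> real"
  assumes S: "S \<in> sets borel" and nonneg: "\<And>x. x \<in> S \<Longrightarrow> 0 \<le> f x"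
    and meas: "(\<lambda>x. ennreal (indicator S x * f x)) \<in> borel_measurable borel"
    and u: "u \<in> borel_measurable borel" "integrable (density lborel (\<lambda>x. ennreal (indicator S x * f x))) u"
  shows "has_bochner_integral (lebesgue_on S) (\<lambda>x. u x * f x)
           (\<integral>x. u x \<partial>density lborel (\<lambda>x. ennreal (indicator S x * f x)))"
proof -
  let ?f = "\<lambda>x. indicator S x * f x"
  have nn: "0 \<le> ?f x" for x using nonneg[of x] by (auto simp: indicator_def)
  have m: "?f \<in> borel_measurable borel"
    using borel_measurable_enn2real[OF meas] by (simp add: nn)
  have fu: "(\<lambda>x. ?f x *\<^sub>R u x) \<in> borel_measurable lborel" using m u(1) by simp
  have Sl: "S \<inter> space lebesgue \<in> sets lebesgue" using S by auto
  have eq: "(\<lambda>x. ?f x *\<^sub>R u x) = (\<lambda>x. indicator S x *\<^sub>R (u x * f x))" by (auto simp: fun_eq_iff)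
  have "integrable lborel (\<lambda>x. ?f x *\<^sub>R u x)"
    using u m nn by (subst (asm) integrable_density) auto
  hence "integrable (lebesgue_on S) (\<lambda>x. u x * f x)"
    unfolding integrable_restrict_space[OF Sl] eq[symmetric] integrable_completion[OF fu] .
  moreover have "(\<integral>x. u x * f x \<partial>lebesgue_on S) = (\<integral>x. u x \<partial>density lborel (\<lambda>x. ennreal (?f x)))"
    unfolding integral_restrict_space[OF Sl] eq[symmetric] integral_completion[OF fu]
    using u m nn by (subst integral_density) auto
  ultimately show ?thesis by (simp add: has_bochner_integral_iff)
qed

text \<open>Hoeffding's inequality bounds these probabilities by a decreasing geometric sequence.\<close>

lemma (in prob_space) weak_law_of_large_numbers_bounded:
  fixes X :: "nat \<Rightarrow> 'a \<Rightarrow> 'b::euclidean_space"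
  assumes indep: "indep_vars (\<lambda>_. borel) X UNIV"
    and distr: "\<And>n. distr M lborel (X n) = D"
    and S: "AE x in D. x \<in> S" and u: "bounded_measurable D S u" and r: "0 < r"
  shows "(\<lambda>N. prob {\<omega> \<in> space M. r \<le> \<bar>sample_mean u N (\<lambda>n. X n \<omega>) - (\<integral>x. u x \<partial>D)\<bar>}) \<longlonglongrightarrow> 0"
proof -
  obtain B where B: "0 < B" "\<And>x. x \<in> S \<Longrightarrow> \<bar>u x\<bar> \<le> B"
  proof -
    obtain B where "\<forall>x\<in>S. \<bar>u x\<bar> \<le> B" using u by (auto simp: bounded_measurable_def)
    with that[of "max B 1"] show thesis by force
  qed
  have sets: "sets D = sets borel" using distr[of 0] by auto
  have um [measurable]: "u \<in> borel_measurable borel"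
    using u sets by (simp add: bounded_measurable_def cong: measurable_cong_sets)
  have X [measurable]: "random_variable borel (X n)" for n
    using indep by (auto simp: indep_vars_def)
  have indepu: "indep_vars (\<lambda>_. borel) (\<lambda>n \<omega>. u (X n \<omega>)) UNIV"
    by (rule indep_vars_compose2[OF indep]) simp
  have mean: "expectation (\<lambda>\<omega>. u (X n \<omega>)) = (\<integral>x. u x \<partial>D)" for n
    unfolding distr[of n, symmetric] by (rule integral_distr[symmetric]) auto
  have AE: "AE \<omega> in M. u (X n \<omega>) \<in> {- B..B}" for n
  proof -
    have "AE \<omega> in M. X n \<omega> \<in> S"
      using S unfolding distr[of n, symmetric] by (rule AE_distrD[rotated]) simp
    thus ?thesis by eventually_elim (use B(2) in \<open>force simp: abs_le_iff minus_le_iff\<close>)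
  qed
  define \<mu> where "\<mu> = (\<integral>x. u x \<partial>D)"
  define c where "c = r\<^sup>2 / (2 * B\<^sup>2)"
  have c: "0 < c" using r B by (simp add: c_def)
  have bound: "prob {\<omega> \<in> space M. r \<le> \<bar>sample_mean u N (\<lambda>n. X n \<omega>) - \<mu>\<bar>} \<le> 2 * exp (- c) ^ N"
    if N: "0 < N" for N
  proof -
    interpret Hoeffding_ineq M "{..<N}" "\<lambda>n \<omega>. u (X n \<omega>)" "\<lambda>_. - B" "\<lambda>_. B" "real N * \<mu>"
    proof unfold_locales
      show "indep_vars (\<lambda>_. borel) (\<lambda>n \<omega>. u (X n \<omega>)) {..<N}"
        by (rule indep_vars_subset[OF indepu]) simp
      show "real N * \<mu> \<equiv> \<Sum>n<N. expectation (\<lambda>\<omega>. u (X n \<omega>))"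
        by (simp add: mean \<mu>_def)
    qed (use AE in auto)
    have "{\<omega> \<in> space M. r \<le> \<bar>sample_mean u N (\<lambda>n. X n \<omega>) - \<mu>\<bar>}
        = {\<omega> \<in> space M. real N * r \<le> \<bar>(\<Sum>n<N. u (X n \<omega>)) - real N * \<mu>\<bar>}"
    proof -
      have "r \<le> \<bar>s / real N - \<mu>\<bar> \<longleftrightarrow> real N * r \<le> \<bar>s - real N * \<mu>\<bar>" for s
      proof -
        have "s - real N * \<mu> = real N * (s / real N - \<mu>)"
          using N by (simp add: right_diff_distrib)
        thus ?thesis using N by (simp add: abs_mult)
      qed
      thus ?thesis by (simp add: sample_mean_def)
    qed
    also have "prob \<dots> \<le> 2 * exp (- 2 * (real N * r)\<^sup>2 / (\<Sum>n<N. (B - (- B))\<^sup>2))"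
      using r N B by (intro Hoeffding_ineq_abs_ge) auto
    also have "- 2 * (real N * r)\<^sup>2 / (\<Sum>n<N. (B - (- B))\<^sup>2) = real N * (- c)"
      using N B by (simp add: c_def power2_eq_square field_simps)
    finally show ?thesis unfolding exp_of_nat_mult .
  qed
  have "(\<lambda>N. 2 * exp (- c) ^ N) \<longlonglongrightarrow> 2 * 0"
    using c by (intro tendsto_intros LIMSEQ_power_zero) auto
  hence lim: "(\<lambda>N. 2 * exp (- c) ^ N) \<longlonglongrightarrow> 0" by simp
  show ?thesis unfolding \<mu>_def[symmetric]
    by (rule tendsto_sandwich[OF _ _ tendsto_const lim])
       (auto intro!: eventually_mono[OF eventually_gt_at_top[of 0]] bound)
qed

section \<open>Approximation by monomials\<close>

definition polynomial_of_degree_upto :: "nat \<Rightarrow> (real ^ 'k \<Rightarrow> real) \<Rightarrow> bool" where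
  "polynomial_of_degree_upto A p \<longleftrightarrow>
     (\<exists>c. p = (\<lambda>x. \<Sum>\<alpha>\<in>multi_indices_upto A. c \<alpha> * monomial \<alpha> x))"

lemma finite_multi_indices_upto: "finite (multi_indices_upto A :: ('k::finite \<Rightarrow> nat) set)"
proof (rule finite_subset)
  show "multi_indices_upto A \<subseteq> PiE (UNIV :: 'k set) (\<lambda>_. {..A})"
  proof
    fix \<alpha> :: "'k \<Rightarrow> nat" assume "\<alpha> \<in> multi_indices_upto A"
    hence "\<alpha> k \<le> A" for k
      using member_le_sum[of k UNIV \<alpha>] by (simp add: multi_indices_upto_def)
    thus "\<alpha> \<in> PiE UNIV (\<lambda>_. {..A})" by auto
  qed
qed (auto intro: finite_PiE)

lemma polynomial_of_degree_upto_monomial: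
  assumes "\<alpha> \<in> multi_indices_upto A"
  shows "polynomial_of_degree_upto A (monomial \<alpha>)"
  unfolding polynomial_of_degree_upto_def
  using assms
  by (intro exI[of _ "\<lambda>\<beta>. if \<beta> = \<alpha> then 1 else 0"]) (rule ext, simp add: finite_multi_indices_upto if_distrib[of "\<lambda>c. c * _"] cong: if_cong)

lemma polynomial_of_degree_upto_add:
  assumes "polynomial_of_degree_upto A p" "polynomial_of_degree_upto A q"
  shows "polynomial_of_degree_upto A (\<lambda>x. p x + q x)"
proof -
  obtain c d where "p = (\<lambda>x. \<Sum>\<alpha>\<in>multi_indices_upto A. c \<alpha> * monomial \<alpha> x)"
    "q = (\<lambda>x. \<Sum>\<alpha>\<in>multi_indices_upto A. d \<alpha> * monomial \<alpha> x)"
    using assms by (auto simp: polynomial_of_degree_upto_def)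
  thus ?thesis unfolding polynomial_of_degree_upto_def
    by (intro exI[of _ "\<lambda>\<alpha>. c \<alpha> + d \<alpha>"]) (simp add: distrib_right sum.distrib)
qed

lemma polynomial_of_degree_upto_scale:
  assumes "polynomial_of_degree_upto A p"
  shows "polynomial_of_degree_upto A (\<lambda>x. r * p x)"
proof -
  obtain c where "p = (\<lambda>x. \<Sum>\<alpha>\<in>multi_indices_upto A. c \<alpha> * monomial \<alpha> x)"
    using assms by (auto simp: polynomial_of_degree_upto_def)
  thus ?thesis unfolding polynomial_of_degree_upto_def
    by (intro exI[of _ "\<lambda>\<alpha>. r * c \<alpha>"]) (simp add: sum_distrib_left mult.assoc)
qed

lemma polynomial_of_degree_upto_sum:
  assumes "\<And>j. j \<in> J \<Longrightarrow> polynomial_of_degree_upto A (p j)"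
  shows "polynomial_of_degree_upto A (\<lambda>x. \<Sum>j\<in>J. p j x)"
proof -
  have zero: "polynomial_of_degree_upto A (\<lambda>_. 0)"
    unfolding polynomial_of_degree_upto_def by (intro exI[of _ "\<lambda>_. 0"]) simp
  show ?thesis using assms
    by (induction J rule: infinite_finite_induct) (auto intro: zero polynomial_of_degree_upto_add)
qed

lemma polynomial_of_degree_upto_mono:
  assumes "polynomial_of_degree_upto A p" "A \<le> B"
  shows "polynomial_of_degree_upto B p"
proof -
  obtain c where "p = (\<lambda>x. \<Sum>\<alpha>\<in>multi_indices_upto A. c \<alpha> * monomial \<alpha> x)"
    using assms by (auto simp: polynomial_of_degree_upto_def)
  moreover have "multi_indices_upto A \<subseteq> multi_indices_upto B"
    using assms(2) by (auto simp: multi_indices_upto_def)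
  ultimately show ?thesis
    by (auto intro!: polynomial_of_degree_upto_sum polynomial_of_degree_upto_scale
        polynomial_of_degree_upto_monomial)
qed

lemma polynomial_of_degree_upto_mult:
  assumes "polynomial_of_degree_upto A p" "polynomial_of_degree_upto B q"
  shows "polynomial_of_degree_upto (A + B) (\<lambda>x. p x * q x)"
proof -
  obtain c d where "p = (\<lambda>x. \<Sum>\<alpha>\<in>multi_indices_upto A. c \<alpha> * monomial \<alpha> x)"
    "q = (\<lambda>x. \<Sum>\<beta>\<in>multi_indices_upto B. d \<beta> * monomial \<beta> x)"
    using assms by (auto simp: polynomial_of_degree_upto_def)
  hence eq: "(\<lambda>x. p x * q x) = (\<lambda>x. \<Sum>\<alpha>\<in>multi_indices_upto A. \<Sum>\<beta>\<in>multi_indices_upto B.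
      (c \<alpha> * d \<beta>) * monomial (\<lambda>k. \<alpha> k + \<beta> k) x)"
    by (simp add: sum_product monomial_def power_add prod.distrib mult_ac)
  show ?thesis unfolding eq
    by (intro polynomial_of_degree_upto_sum polynomial_of_degree_upto_scale
        polynomial_of_degree_upto_monomial) (auto simp: multi_indices_upto_def sum.distrib)
qed

lemma real_polynomial_function_imp_polynomial_of_degree_upto:
  assumes "real_polynomial_function (p :: real ^ 'k \<Rightarrow> real)"
  shows "\<exists>A. polynomial_of_degree_upto A p"
  using assms
proof induction
  case (linear p)
  interpret bounded_linear p by fact
  have "p x = (\<Sum>k\<in>UNIV. p (axis k 1) * monomial (\<lambda>i. if i = k then 1 else 0) x)" for x
  proof -
    have monomial: "monomial (\<lambda>i. if i = k then 1 else 0) x = x $ k" for k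
      by (simp add: monomial_def if_distrib[of "\<lambda>n. _ ^ n"] cong: if_cong)
    have "p x = p (\<Sum>k\<in>UNIV. x $ k *\<^sub>R axis k 1)"
      using basis_expansion[of x] by (simp add: scalar_mult_eq_scaleR)
    also have "\<dots> = (\<Sum>k\<in>UNIV. p (axis k 1) * x $ k)"
      by (simp add: sum scaleR mult.commute)
    finally show ?thesis unfolding monomial .
  qed
  hence eq: "p = (\<lambda>x. \<Sum>k\<in>UNIV. p (axis k 1) * monomial (\<lambda>i. if i = k then 1 else 0) x)" ..
  have "polynomial_of_degree_upto 1 p"
    by (subst eq) (intro polynomial_of_degree_upto_sum polynomial_of_degree_upto_scale
        polynomial_of_degree_upto_monomial, simp add: multi_indices_upto_def)
  thus ?case by blast
next
  case (const c)
  have eq: "(\<lambda>x. c) = (\<lambda>x. c * monomial (\<lambda>_::'k. 0) x)" by (simp add: monomial_def)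
  have "polynomial_of_degree_upto 0 (\<lambda>x::real ^ 'k. c)"
    by (subst eq) (intro polynomial_of_degree_upto_scale polynomial_of_degree_upto_monomial,
       simp add: multi_indices_upto_def)
  thus ?case by blast
next
  case (add p q)
  then obtain A B where "polynomial_of_degree_upto A p" "polynomial_of_degree_upto B q" by blast
  hence "polynomial_of_degree_upto (max A B) (\<lambda>x. p x + q x)"
    by (intro polynomial_of_degree_upto_add) (auto intro: polynomial_of_degree_upto_mono)
  thus ?case by blast
next
  case (mult p q)
  thus ?case by (blast intro: polynomial_of_degree_upto_mult)
qed

text \<open>The Stone--Weierstrass theorem in coordinates. The degree is raised by one to make it positive.\<close>

lemma Weierstrass_monomials:
  fixes S :: "(real ^ 'k) set"
  assumes "compact S" "continuous_on S \<phi>" "0 < \<eta>"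
  shows "\<exists>A>0. \<exists>c. \<forall>x\<in>S. \<bar>\<phi> x - (\<Sum>\<alpha>\<in>multi_indices_upto A. c \<alpha> * monomial \<alpha> x)\<bar> < \<eta>"
proof -
  obtain p where p: "real_polynomial_function p" "\<And>x. x \<in> S \<Longrightarrow> \<bar>\<phi> x - p x\<bar> < \<eta>"
    using Stone_Weierstrass_real_polynomial_function[OF assms] by blast
  obtain A where "polynomial_of_degree_upto A p"
    using real_polynomial_function_imp_polynomial_of_degree_upto[OF p(1)] by blast
  hence "polynomial_of_degree_upto (Suc A) p" by (rule polynomial_of_degree_upto_mono) simp
  then obtain c where "p = (\<lambda>x. \<Sum>\<alpha>\<in>multi_indices_upto (Suc A). c \<alpha> * monomial \<alpha> x)"
    by (auto simp: polynomial_of_degree_upto_def)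
  with p(2) show ?thesis by (intro exI[of _ "Suc A"] conjI exI[of _ c]) auto
qed

section \<open>Consistency of the optimum information estimator\<close>

lemma continuous_on_monomial: "continuous_on S (monomial \<alpha>)"
  unfolding monomial_def by (intro continuous_intros)

lemma sample_mean_linear_combination:
  assumes "\<And>n. T (x n) = (\<Sum>j<m. a j * e j (x n))"
  shows "sample_mean T N x = (\<Sum>j<m. a j * sample_mean (e j) N x)"
  unfolding sample_mean_def assms
  by (subst sum.swap) (simp add: sum_divide_distrib sum_distrib_left)

theorem theorem5:
  fixes S :: "(real ^ 'k) set"
    and f :: "real ^ 'k \<Rightarrow> real"
    and M :: "'w measure"
    and X :: "nat \<Rightarrow> 'w \<Rightarrow> real ^ 'k"
    and \<epsilon> :: real
  assumes "compact S"
    and "continuous_on S f"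
    and "\<And>x. x \<in> S \<Longrightarrow> f x > 0"
    and "(\<integral>x. f x \<partial>lebesgue_on S) = 1"
    and "prob_space M"
    and "prob_space.indep_vars M (\<lambda>_. borel) X UNIV"
    and "\<And>n. distributed M lborel (X n) (\<lambda>x. ennreal (indicator S x * f x))"
    and "\<epsilon> > 0"
  shows "\<exists>A::nat. A > 0 \<and> (\<forall>\<delta>::real. \<delta> > 0 \<longrightarrow>
    (\<lambda>N. outer_measure_of M
       {\<omega> \<in> space M. \<exists>g. is_optimum_information_estimator S (multi_indices_upto A) monomial N
                               (\<lambda>n. X n \<omega>) g \<and>
                           kl_info S f g > ereal (\<epsilon> + \<delta>)})
      \<longlonglongrightarrow> 0)"
proof -
  interpret prob_space M by fact
  have "continuous_on S (\<lambda>x. ln (f x))"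
    using assms(3) by (intro continuous_on_ln assms(2)) (auto simp: less_imp_neq[THEN not_sym])
  from Weierstrass_monomials[OF assms(1) this, of "\<epsilon> / 2"] assms(8)
  obtain A c where A: "0 < A"
    and p: "\<And>x. x \<in> S \<Longrightarrow> \<bar>ln (f x) - (\<Sum>\<alpha>\<in>multi_indices_upto A. c \<alpha> * monomial \<alpha> x)\<bar> < \<epsilon> / 2"
    by auto
  let ?I = "multi_indices_upto A :: ('k \<Rightarrow> nat) set"
  note fin_I = finite_multi_indices_upto[of A, where 'k = 'k]
  have S_borel: "S \<in> sets borel" using assms(1) by (rule borel_compact)

  define D where "D = density lborel (\<lambda>x. ennreal (indicator S x * f x))"
  have distr: "distr M lborel (X n) = D" for n
    using distributed_distr_eq_density[OF assms(7)] by (simp add: D_def)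
  have Xm [measurable]: "random_variable borel (X n)" for n
    using assms(6) by (auto simp: indep_vars_def)
  have D_fin: "finite_measure D"
    unfolding distr[of 0, symmetric] by (rule finite_measure_distr) simp
  have f_meas: "(\<lambda>x. ennreal (indicator S x * f x)) \<in> borel_measurable borel"
    using distributed_borel_measurable[OF assms(7)[of 0]] by simp
  have D_S: "AE x in D. x \<in> S"
    unfolding D_def using f_meas by (subst AE_density) (auto simp: indicator_def)
  note D = D_fin D_S
  have bm_borel: "u \<in> borel_measurable borel" if "bounded_measurable D S u" for u
    using that by (simp add: bounded_measurable_def D_def cong: measurable_cong_sets)
  have bm_monomial: "bounded_measurable D S (monomial \<alpha>)" for \<alpha> :: "'k \<Rightarrow> nat"
  proof -
    have "monomial \<alpha> \<in> borel_measurable D"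
      using borel_measurable_continuous_onI[OF continuous_on_monomial, of \<alpha>]
      by (simp add: D_def cong: measurable_cong_sets)
    moreover have "\<exists>B. \<forall>x\<in>S. \<bar>monomial \<alpha> x\<bar> \<le> B"
      using compact_imp_bounded[OF compact_continuous_image[OF continuous_on_monomial assms(1)], of \<alpha>]
      by (auto simp: bounded_iff)
    ultimately show ?thesis by (simp add: bounded_measurable_def)
  qed

  obtain m e where e: "orthonormal_system D S m e"
    and span: "\<forall>\<alpha>\<in>?I. \<exists>a. AE x in D. monomial \<alpha> x = (\<Sum>j<m. a j * e j x)"
    using gram_schmidt_modulo_null_sets[OF D fin_I, of monomial] bm_monomial by blast
  from bchoice[OF span] obtain a where
    a: "\<And>\<alpha>. \<alpha> \<in> ?I \<Longrightarrow> AE x in D. monomial \<alpha> x = (\<Sum>j<m. a \<alpha> j * e j x)" by blast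
  have bm_e: "bounded_measurable D S (e j)" if "j < m" for j
    using e that by (auto simp: orthonormal_system_def)
  have "\<forall>j\<in>{..<m}. \<exists>B. \<forall>x\<in>S. \<bar>e j x\<bar> \<le> B"
    using bm_e by (auto simp: bounded_measurable_def)
  from bchoice[OF this] obtain B0 where
    B0: "\<And>j x. j < m \<Longrightarrow> x \<in> S \<Longrightarrow> \<bar>e j x\<bar> \<le> B0 j" by blast
  define B where "B = (\<Sum>j<m. \<bar>B0 j\<bar>)"
  have B_nonneg: "0 \<le> B" unfolding B_def by (simp add: sum_nonneg)

  show ?thesis
  proof (intro exI[of _ A] conjI A allI impI)
    fix \<delta> :: real assume \<delta>: "0 < \<delta>"
    \<comment> \<open>The value that turns \<open>(\<epsilon> + 3 \<rho>) / (1 - \<rho>)\<close> into \<open>\<epsilon> + \<delta>\<close>.\<close>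
    define \<rho> where "\<rho> = \<delta> / (3 + \<epsilon> + \<delta>)"
    have \<rho>: "0 < \<rho>" "\<rho> < 1" and \<rho>_le: "(2 * (\<epsilon> / 2) + 3 * \<rho>) / (1 - \<rho>) \<le> \<epsilon> + \<delta>"
    proof -
      show "0 < \<rho>" "\<rho> < 1" using \<delta> assms(8) by (auto simp: \<rho>_def)
      moreover have "\<rho> * (3 + \<epsilon> + \<delta>) = \<delta>" using \<delta> assms(8) by (simp add: \<rho>_def)
      hence "\<epsilon> + 3 * \<rho> = (\<epsilon> + \<delta>) * (1 - \<rho>)" by (simp add: algebra_simps)
      ultimately show "(2 * (\<epsilon> / 2) + 3 * \<rho>) / (1 - \<rho>) \<le> \<epsilon> + \<delta>" by simp
    qed
    \<comment> \<open>Deviations of at most \<open>r\<close> in every coordinate keep the tilt below \<open>\<rho>\<close> on \<open>S\<close>; the summand \<open>1\<close> covers \<open>B = 0\<close>.\<close>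
    define r where "r = \<rho> / (1 + B)"
    have r: "0 < r" "r * B \<le> \<rho>"
      using \<rho> B_nonneg by (auto simp: r_def pos_divide_le_eq algebra_simps)
    define d where "d j N \<omega> = sample_mean (e j) N (\<lambda>n. X n \<omega>) - (\<integral>x. e j x \<partial>D)" for j N \<omega>
    define bad where "bad j N = {\<omega> \<in> space M. r \<le> \<bar>d j N \<omega>\<bar>}" for j N
    define E where "E N = {\<omega> \<in> space M. \<exists>g. is_optimum_information_estimator S ?I monomial N
        (\<lambda>n. X n \<omega>) g \<and> kl_info S f g > ereal (\<epsilon> + \<delta>)}" for N
    have bad_sets: "bad j N \<in> sets M" if "j < m" for j N
    proof -
      have [measurable]: "e j \<in> borel_measurable borel" by (rule bm_borel[OF bm_e[OF that]])
      show ?thesis unfolding bad_def d_def sample_mean_def by measurable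
    qed
    \<comment> \<open>The expansions in the orthonormal system hold only almost everywhere, hence almost surely at all
        sample points; \<open>Z\<close> below collects the exceptional outcomes.\<close>
    define spanned where "spanned \<omega> \<longleftrightarrow>
        (\<forall>n. \<forall>\<alpha>\<in>?I. monomial \<alpha> (X n \<omega>) = (\<Sum>j<m. a \<alpha> j * e j (X n \<omega>)))" for \<omega>
    have "AE \<omega> in M. spanned \<omega>"
      unfolding spanned_def
    proof (subst AE_all_countable, intro allI AE_finite_allI[OF fin_I])
      fix n \<alpha> assume \<alpha>: "\<alpha> \<in> ?I"
      show "AE \<omega> in M. monomial \<alpha> (X n \<omega>) = (\<Sum>j<m. a \<alpha> j * e j (X n \<omega>))"
        using a[OF \<alpha>] unfolding distr[of n, symmetric] by (rule AE_distrD[rotated]) simp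
    qed
    then obtain Z where Z_span: "\<And>\<omega>. \<omega> \<in> space M - Z \<Longrightarrow> spanned \<omega>" and Z: "Z \<in> null_sets M"
      by (rule AE_E3) blast
    have E_sub: "E N \<subseteq> (\<Union>j<m. bad j N) \<union> Z" if N: "0 < N" for N
    proof
      fix \<omega> assume "\<omega> \<in> E N"
      then obtain g where \<omega>: "\<omega> \<in> space M"
        and g: "is_optimum_information_estimator S ?I monomial N (\<lambda>n. X n \<omega>) g"
        and kl: "kl_info S f g > ereal (\<epsilon> + \<delta>)" by (auto simp: E_def)
      show "\<omega> \<in> (\<Union>j<m. bad j N) \<union> Z"
      proof (rule ccontr)
        assume "\<omega> \<notin> (\<Union>j<m. bad j N) \<union> Z"
        hence Z': "\<omega> \<notin> Z" and small: "\<And>j. j < m \<Longrightarrow> \<bar>d j N \<omega>\<bar> \<le> r"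
          using \<omega> by (auto simp: bad_def not_le intro: less_imp_le)
        \<comment> \<open>The tilt that gives \<open>f (1 + q)\<close> the sample moments.\<close>
        define q where "q x = (\<Sum>j<m. d j N \<omega> * e j x)" for x
        define \<tau> where "\<tau> \<alpha> = sample_mean (monomial \<alpha>) N (\<lambda>n. X n \<omega>)" for \<alpha> :: "'k \<Rightarrow> nat"
        have bm_q: "bounded_measurable D S q"
          unfolding q_def using bm_e by (auto intro!: bounded_measurable_intros)
        have q_le: "\<bar>q x\<bar> \<le> \<rho>" if x: "x \<in> S" for x
        proof -
          have "\<bar>q x\<bar> \<le> (\<Sum>j<m. \<bar>d j N \<omega> * e j x\<bar>)" unfolding q_def by (rule sum_abs)
          also have "\<dots> \<le> (\<Sum>j<m. r * \<bar>B0 j\<bar>)"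
            using small order_trans[OF B0[OF _ x] abs_ge_self] r(1)
            by (intro sum_mono) (auto simp: abs_mult intro!: mult_mono)
          also have "\<dots> = r * B" by (simp add: B_def sum_distrib_left)
          finally show ?thesis using r(2) by simp
        qed
        have moments: "has_bochner_integral (lebesgue_on S) (\<lambda>x. monomial \<alpha> x * (f x * (1 + q x))) (\<tau> \<alpha>)"
          if \<alpha>: "\<alpha> \<in> ?I" for \<alpha>
        proof -
          have bm: "bounded_measurable D S (\<lambda>x. monomial \<alpha> x * (1 + q x))"
            by (intro bounded_measurable_intros bm_monomial bm_q)
          have "(\<integral>x. monomial \<alpha> x * (1 + q x) \<partial>D) = (\<Sum>j<m. a \<alpha> j * ((\<integral>x. e j x \<partial>D) + d j N \<omega>))"
            unfolding q_def by (rule integral_mult_orthonormal_perturbation[OF D e bm_monomial a[OF \<alpha>]])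
          also have "\<dots> = (\<Sum>j<m. a \<alpha> j * sample_mean (e j) N (\<lambda>n. X n \<omega>))" by (simp add: d_def)
          also have "\<dots> = \<tau> \<alpha>"
            unfolding \<tau>_def
            using Z_span[of \<omega>] \<omega> Z' \<alpha> unfolding spanned_def by (intro sample_mean_linear_combination[symmetric]) auto
          finally have eq: "(\<integral>x. monomial \<alpha> x * (1 + q x) \<partial>D) = \<tau> \<alpha>" .
          have "has_bochner_integral (lebesgue_on S) (\<lambda>x. (monomial \<alpha> x * (1 + q x)) * f x)
              (\<integral>x. monomial \<alpha> x * (1 + q x) \<partial>D)"
            unfolding D_def using bounded_measurable_integrable[OF D bm] assms(3)
            by (intro has_bochner_integral_lebesgue_on_density S_borel f_meas bm_borel[OF bm])
               (auto simp: D_def less_imp_le)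
          thus ?thesis by (simp add: eq mult_ac)
        qed
        \<comment> \<open>Total mass one is the moment with multi-index \<open>0\<close>; its sample mean is \<open>1\<close> because \<open>N > 0\<close>.\<close>
        have zero: "(\<lambda>_. 0) \<in> ?I" by (simp add: multi_indices_upto_def)
        have one: "monomial (\<lambda>_::'k. 0) = (\<lambda>_. 1)" by (simp add: monomial_def fun_eq_iff)
        have "\<tau> (\<lambda>_. 0) = 1" using N by (simp add: \<tau>_def one sample_mean_def)
        with moments[OF zero] moments
        have h: "(\<lambda>x. f x * (1 + q x)) \<in> moment_feasible S ?I monomial \<tau>"
          by (simp add: moment_feasible_def one)
        have "q \<in> borel_measurable (lebesgue_on S)"
          using bm_borel[OF bm_q] by (intro measurable_restrict_space1 measurable_completion) simp
        hence "kl_info S f g \<le> ereal ((2 * (\<epsilon> / 2) + 3 * \<rho>) / (1 - \<rho>))"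
          using g p \<rho> q_le h
          by (intro entropy_minimizer_kl_info_le[where c = c, OF assms(1-4) fin_I refl])
             (auto simp: is_optimum_information_estimator_def \<tau>_def[abs_def] intro: less_imp_le)
        also have "\<dots> \<le> ereal (\<epsilon> + \<delta>)" using \<rho>_le by simp
        finally show False using kl by simp
      qed
    qed
    have bound: "outer_measure_of M (E N) \<le> ennreal (\<Sum>j<m. prob (bad j N))" if "0 < N" for N
    proof -
      have "outer_measure_of M (E N) \<le> outer_measure_of M ((\<Union>j<m. bad j N) \<union> Z)"
        by (rule outer_measure_of_mono[OF E_sub[OF that]])
      also have "\<dots> = emeasure M ((\<Union>j<m. bad j N) \<union> Z)"
        using bad_sets Z by (intro outer_measure_of_eq) auto
      also have "\<dots> = emeasure M (\<Union>j<m. bad j N)"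
        using bad_sets Z by (intro emeasure_Un_null_set) auto
      also have "\<dots> \<le> (\<Sum>j<m. emeasure M (bad j N))"
        using bad_sets by (intro emeasure_subadditive_finite) auto
      also have "\<dots> = ennreal (\<Sum>j<m. prob (bad j N))"
        by (simp add: emeasure_eq_measure)
      finally show ?thesis .
    qed
    have "(\<lambda>N. prob (bad j N)) \<longlonglongrightarrow> 0" if "j < m" for j
      unfolding bad_def d_def
      by (rule weak_law_of_large_numbers_bounded[OF assms(6) distr D_S bm_e[OF that] r(1)])
    hence "(\<lambda>N. \<Sum>j<m. prob (bad j N)) \<longlonglongrightarrow> (\<Sum>j<m. 0)" by (intro tendsto_sum) auto
    hence lim: "(\<lambda>N. ennreal (\<Sum>j<m. prob (bad j N))) \<longlonglongrightarrow> 0"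
      using tendsto_ennrealI by fastforce
    have "(\<lambda>N. outer_measure_of M (E N)) \<longlonglongrightarrow> 0"
    proof (rule tendsto_sandwich[OF _ _ tendsto_const lim])
      show "\<forall>\<^sub>F N in sequentially. outer_measure_of M (E N) \<le> ennreal (\<Sum>j<m. prob (bad j N))"
        using eventually_gt_at_top[of 0] by eventually_elim (rule bound)
    qed simp
    thus "(\<lambda>N. outer_measure_of M {\<omega> \<in> space M. \<exists>g. is_optimum_information_estimator S
        (multi_indices_upto A) monomial N (\<lambda>n. X n \<omega>) g \<and> kl_info S f g > ereal (\<epsilon> + \<delta>)}) \<longlonglongrightarrow> 0"
      unfolding E_def .
  qed
qed

end
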